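(* Let $\tau = \tau_1\tau_2\tau_3\cdots = 01101001\cdots$ be the Thue--Morse sequence, where $\tau_n\in\{0,1\}$ is the parity of the number of $1$'s in the binary representation of $n-1$ (so $\tau_1=0$). For every integer $k \geq 1$, $\tau_1 \tau_2\cdots \tau_{4k} \preccurlyeq \overline{\tau_1\tau_2 \cdots \tau_{4k}}$; that is, writing $\alpha=\tau_1\cdots\tau_{4k}$ and $\bar\alpha$ for its bitwise complement, $I_{\alpha}(x)\le I_{\bar\alpha}(x)$ for all $x\in[0,1]$.
   Context: For a finite bit string define a reliability polynomial as follows. $I(x)=x$ for the empty string, $I_0(x)=x^2$, $I_1(x)=1-(1-x)^2$, and $I_{a_1a_2\cdots a_\ell}(x)=I_{a_2\cdots a_\ell}(I_{a_1}(x))$ for $a_1\cdots a_\ell\in\{0,1\}^\ell$ (the first bit is applied first). For bit strings $\alpha,\gamma$ (possibly of different lengths), $\alpha\succcurlyeq\gamma$ (equivalently $\gamma\preccurlyeq\alpha$) means $I_\alpha(x)\ge I_\gamma(x)$ for all $x\in[0,1]$. The overline denotes bitwise complement, e.g. $\overline{1000}=0111$. *)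

theory Defs
  imports Complex_Main
begin

text \<open>
  Bit strings are lists over \<^typ>\<open>bool\<close>, where \<^term>\<open>True\<close> stands for the bit 1
  and \<^term>\<open>False\<close> for the bit 0.
\<close>

type_synonym bitstring = "bool list"

primrec rel_poly_bit :: "bool \<Rightarrow> real \<Rightarrow> real" where
  "rel_poly_bit False x = x ^ 2"
| "rel_poly_bit True x = 1 - (1 - x) ^ 2"

primrec rel_poly :: "bitstring \<Rightarrow> real \<Rightarrow> real" where
  "rel_poly [] x = x"
| "rel_poly (a # w) x = rel_poly w (rel_poly_bit a x)"

definition rel_le :: "bitstring \<Rightarrow> bitstring \<Rightarrow> bool"  (infix \<open>\<preceq>\<close> 50) where
  "\<gamma> \<preceq> \<alpha> \<longleftrightarrow> (\<forall>x\<in>{0..1}. rel_poly \<gamma> x \<le> rel_poly \<alpha> x)"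

definition bit_complement :: "bitstring \<Rightarrow> bitstring" where
  "bit_complement w = map Not w"

text \<open>The Thue--Morse sequence is indexed from 1; its value at index 0 is irrelevant.\<close>

definition thue_morse :: "nat \<Rightarrow> bool" where
  "thue_morse n \<longleftrightarrow> odd (card {i. bit (n - 1) i})"

definition thue_morse_prefix :: "nat \<Rightarrow> bitstring" where
  "thue_morse_prefix m = map thue_morse [1..<Suc m]"

text \<open>The cardinality above is that of a finite set, and the first eight terms are 01101001:\<close>

lemma bits_rec:
  "{i. bit (n::nat) i} = (if odd n then {0} else {}) \<union> Suc ` {i. bit (n div 2) i}"
proof (rule set_eqI)
  fix i
  show "i \<in> {i. bit n i} \<longleftrightarrow> i \<in> (if odd n then {0} else {}) \<union> Suc ` {i. bit (n div 2) i}"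
    by (cases i) (auto simp: bit_0 bit_Suc)
qed

lemma finite_bits: "finite {i. bit (n::nat) i}"
proof (induction n rule: less_induct)
  case (less n)
  then show ?case
    by (cases "n = 0") (simp_all add: bits_rec [of n])
qed

lemma odd_card_bits_rec:
  "odd (card {i. bit (n::nat) i}) \<longleftrightarrow> (odd n \<noteq> odd (card {i. bit (n div 2) i}))"
proof -
  have "card (Suc ` {i. bit (n div 2) i}) = card {i. bit (n div 2) i}"
    by (simp add: card_image)
  moreover have "finite (Suc ` {i. bit (n div 2) i})" "0 \<notin> Suc ` {i. bit (n div 2) i}"
    by (auto simp: finite_bits)
  ultimately show ?thesis
    by (subst bits_rec) auto
qed

lemma thue_morse_prefix_8:
  "thue_morse_prefix 8 = [False, True, True, False, True, False, False, True]"
proof -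
  have 0: "\<not> odd (card {i. bit (0::nat) i})" by simp
  have 1: "odd (card {i. bit (1::nat) i})" using 0 odd_card_bits_rec [of 1] by simp
  have 2: "odd (card {i. bit (2::nat) i})" using 1 odd_card_bits_rec [of 2] by simp
  have 3: "\<not> odd (card {i. bit (3::nat) i})" using 1 odd_card_bits_rec [of 3] by simp
  have 4: "odd (card {i. bit (4::nat) i})" using 2 odd_card_bits_rec [of 4] by simp
  have 5: "\<not> odd (card {i. bit (5::nat) i})" using 2 odd_card_bits_rec [of 5] by simp
  have 6: "\<not> odd (card {i. bit (6::nat) i})" using 3 odd_card_bits_rec [of 6] by simp
  have 7: "odd (card {i. bit (7::nat) i})" using 3 odd_card_bits_rec [of 7] by simp
  have "[1..<Suc 8] = [1, 2, 3, 4, 5, 6, 7, 8]"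
    by (simp add: upt_rec)
  with 0 1 2 3 4 5 6 7 show ?thesis
    by (simp add: thue_morse_prefix_def thue_morse_def)
qed

end

theory Submission
  imports Defs "HOL-Computational_Algebra.Polynomial"
begin

text \<open>
  Cut the Thue--Morse word into the blocks 0110 and 1001, and pass from the probability \<open>x\<close> to the
  odds \<open>r = x / (1 - x)\<close>.  If two odds differ by a factor of at least 14/11, then they still do
  after any block is applied to the smaller one and the complementary block to the larger one; and
  the first pair of blocks, applied to equal odds, creates this factor.  So the claim
  holds for every sequence of blocks that starts with 0110.

  The factor must be at least the cube root of 2, about 1.26 (small odds in the inductive step), and
  at most \<open>(34911 / 30625)\<^sup>2\<close>, about 1.2995 (equal odds 1).  For 14/11 both rational
  inequalities become, after clearing denominators, polynomials with nonnegative coefficients.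
\<close>

section \<open>Reliability in terms of odds\<close>

text \<open>The maps \<open>rel_poly_bit a\<close> conjugated by \<open>x = r / (1 + r)\<close>. In
  the second equation \<open>1 + r\<close> is squared.\<close>

primrec odds_bit :: "bool \<Rightarrow> real \<Rightarrow> real" where
  "odds_bit False r = r\<^sup>2 / (1 + 2 * r)"
| "odds_bit True r = r\<^sup>2 + 2 * r"

primrec odds_poly :: "bitstring \<Rightarrow> real \<Rightarrow> real" where
  "odds_poly [] r = r"
| "odds_poly (a # w) r = odds_poly w (odds_bit a r)"

lemma odds_bit_pos: "0 < r \<Longrightarrow> 0 < odds_bit a r"
  by (cases a) (simp_all add: add_pos_pos)

text \<open>Cross-multiplication that keeps the scalars 14 and 11 apart, so that its last premise is
  literally one of the polynomial inequalities below.\<close>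

lemma scaled_divide_le_scaled_divide:
  fixes a b c d x y :: "'a::linordered_field"
  assumes "0 < b" "0 < d" "x * (a * d) \<le> y * (c * b)"
  shows "x * (a / b) \<le> y * (c / d)"
  using assms by (simp add: field_simps)

lemma odds_bit_mono:
  assumes "0 < r" "r \<le> s"
  shows "odds_bit a r \<le> odds_bit a s"
proof (cases a)
  case True
  with assms show ?thesis
    by (simp add: add_mono power_mono)
next
  case False
  \<comment> \<open>This product is the difference of the two cross-multiplied sides.\<close>
  have "0 \<le> (s - r) * (s + r + 2 * r * s)"
    using assms by simp
  then have "1 * (r\<^sup>2 * (1 + 2 * s)) \<le> 1 * (s\<^sup>2 * (1 + 2 * r))"
    by (simp add: algebra_simps power2_eq_square)
  then have "1 * (r\<^sup>2 / (1 + 2 * r)) \<le> 1 * (s\<^sup>2 / (1 + 2 * s))"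
    using assms by (intro scaled_divide_le_scaled_divide) simp_all
  with False show ?thesis
    by simp
qed

lemma rel_poly_bit_odds:
  assumes "0 < r"
  shows "rel_poly_bit a (r / (1 + r)) = odds_bit a r / (1 + odds_bit a r)"
proof (cases a)
  case True
  have "1 - r / (1 + r) = 1 / (1 + r)" "odds_bit True r = (1 + r)\<^sup>2 - 1"
    using assms by (simp_all add: field_simps power2_eq_square)
  with True assms show ?thesis
    by (simp add: diff_divide_distrib power_one_over del: odds_bit.simps)
next
  case False
  have "1 + odds_bit False r = (1 + r)\<^sup>2 / (1 + 2 * r)"
    using assms by (simp add: field_simps power2_eq_square)
  with False assms show ?thesis
    by (simp add: power_divide)
qed

lemma odds_poly_append: "odds_poly (v @ w) r = odds_poly w (odds_poly v r)"
  by (induction v arbitrary: r) simp_all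

lemma odds_poly_pos: "0 < r \<Longrightarrow> 0 < odds_poly w r"
  by (induction w arbitrary: r) (simp_all add: odds_bit_pos)

lemma odds_poly_mono: "0 < r \<Longrightarrow> r \<le> s \<Longrightarrow> odds_poly w r \<le> odds_poly w s"
  by (induction w arbitrary: r s) (simp_all add: odds_bit_pos odds_bit_mono)

lemma rel_poly_odds:
  "0 < r \<Longrightarrow> rel_poly w (r / (1 + r)) = odds_poly w r / (1 + odds_poly w r)"
  by (induction w arbitrary: r) (simp_all add: rel_poly_bit_odds odds_bit_pos)

lemma rel_poly_0 [simp]: "rel_poly w 0 = 0"
proof (induction w)
  case (Cons a w)
  then show ?case by (cases a) simp_all
qed simp

lemma rel_poly_1 [simp]: "rel_poly w 1 = 1"
proof (induction w)
  case (Cons a w)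
  then show ?case by (cases a) simp_all
qed simp

text \<open>The endpoints 0 and 1 are fixed by every word; between them \<open>r / (1 + r)\<close>
  is increasing in \<open>r\<close>.\<close>

lemma rel_le_if_odds_le:
  assumes "\<And>r. 0 < r \<Longrightarrow> odds_poly v r \<le> odds_poly w r"
  shows "v \<preceq> w"
  unfolding rel_le_def
proof
  fix x :: real
  assume "x \<in> {0..1}"
  then consider "x = 0" | "x = 1" | "0 < x" "x < 1"
    by fastforce
  then show "rel_poly v x \<le> rel_poly w x"
  proof cases
    case 3
    define r where "r = x / (1 - x)"
    have r: "0 < r" and x: "x = r / (1 + r)"
      using 3 by (simp_all add: r_def field_simps)
    show ?thesis
      using assms [OF r] odds_poly_pos [OF r, of v] odds_poly_pos [OF r, of w]
      by (simp add: x rel_poly_odds [OF r] field_simps)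
  qed simp_all
qed

section \<open>Closed forms for the two blocks\<close>

text \<open>The image of \<open>b\<close> under the square of the substitution 0 -> 01, 1 ->
  10.\<close>

definition block :: "bool \<Rightarrow> bitstring" where
  "block b = [b, \<not> b, \<not> b, b]"

text \<open>The first 0 turns \<open>1 + r\<close> into
  \<open>(1 + r)\<^sup>2 / (1 + 2 * r)\<close>, and the two 1s raise this to the fourth power
  \<open>P / Q\<close>. The last 0 then acts on the odds \<open>P / Q - 1\<close>.\<close>

lemma odds_block_False:
  assumes "0 < r"
  defines "P \<equiv> (1 + r) ^ 8" and "Q \<equiv> (1 + 2 * r) ^ 4"
  shows "odds_poly (block False) r = (P - Q)\<^sup>2 / (Q * (2 * P - Q))"
proof -
  have Q: "Q > 0"
    using assms by simp
  have "Q \<le> ((1 + r)\<^sup>2) ^ 4"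
    unfolding Q_def using assms by (intro power_mono) (simp_all add: power2_eq_square algebra_simps)
  then have QP: "Q \<le> P"
    by (simp add: P_def flip: power_mult)
  have two: "odds_bit True (odds_bit True y) = (1 + y) ^ 4 - 1" for y
    by (simp add: algebra_simps power2_eq_square power4_eq_xxxx)
  have "1 + odds_bit False r = (1 + r)\<^sup>2 / (1 + 2 * r)"
    using assms by (simp add: field_simps power2_eq_square)
  then have y: "odds_bit True (odds_bit True (odds_bit False r)) = (P - Q) / Q"
    using Q unfolding two by (simp add: P_def Q_def power_divide diff_divide_distrib flip: power_mult)
  have "1 + 2 * ((P - Q) / Q) = (2 * P - Q) / Q"
    using Q by (simp add: field_simps)
  then have "odds_bit False ((P - Q) / Q) = (P - Q)\<^sup>2 / (Q * (2 * P - Q))"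
    using Q QP by (simp add: power2_eq_square)
  with y show ?thesis
    by (simp add: block_def del: odds_bit.simps)
qed

text \<open>After the first 1 the odds are \<open>s\<close>. The two 0s raise the probability
  \<open>s / (1 + s)\<close> to the fourth power \<open>R / P\<close>, with odds
  \<open>R / (P - R)\<close>.\<close>

lemma odds_block_True:
  assumes "0 < r"
  defines "P \<equiv> (1 + r) ^ 8" and "R \<equiv> (r * (r + 2)) ^ 4"
  shows "odds_poly (block True) r = R * (2 * P - R) / (P - R)\<^sup>2"
proof -
  define s where "s = r * (r + 2)"
  have s: "s > 0"
    using assms by (simp add: s_def)
  have R: "R = s ^ 4"
    by (simp add: R_def s_def)
  have "1 + s = (1 + r)\<^sup>2"
    by (simp add: s_def power2_eq_square algebra_simps)
  then have "P = (1 + s) ^ 4"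
    by (simp add: P_def flip: power_mult)
  \<comment> \<open>A difference of fourth powers; its factors are the denominators met in the two
    applications of 0.\<close>
  then have PR: "P - R = (1 + 2 * s) * (1 + 2 * s + 2 * s\<^sup>2)"
    by (simp add: R power4_eq_xxxx power2_eq_square algebra_simps)
  have pos: "1 + 2 * s > 0" "1 + 2 * s + 2 * s\<^sup>2 > 0"
    using s by (simp_all add: add_pos_pos)
  have "odds_bit True r = s"
    by (simp add: s_def power2_eq_square algebra_simps)
  moreover have "odds_bit False (odds_bit False s) = R / (P - R)"
  proof -
    have "1 + 2 * (s\<^sup>2 / (1 + 2 * s)) = (1 + 2 * s + 2 * s\<^sup>2) / (1 + 2 * s)"
      using pos by (simp add: field_simps)
    moreover have "R = (s\<^sup>2)\<^sup>2"
      by (simp add: R flip: power_mult)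
    ultimately show ?thesis
      unfolding PR using pos by (simp add: power_divide power2_eq_square)
  qed
  moreover have "odds_bit True (R / (P - R)) = R * (2 * P - R) / (P - R)\<^sup>2"
  proof -
    have "P - R \<noteq> 0"
      using pos PR by simp
    moreover have "R * (2 * P - R) = R\<^sup>2 + 2 * R * (P - R)"
      by (simp add: power2_eq_square algebra_simps)
    ultimately show ?thesis
      by (simp add: power_divide add_divide_distrib power2_eq_square)
  qed
  ultimately show ?thesis
    by (simp add: block_def del: odds_bit.simps)
qed

section \<open>The two polynomial inequalities\<close>

lemma poly_nonneg_if_coeffs_nonneg:
  fixes p :: "'a::linordered_idom poly"
  assumes "\<forall>c\<in>set (coeffs p). 0 \<le> c" "0 \<le> x"
  shows "0 \<le> poly p x"
proof -
  have "0 \<le> coeff p i" for i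
    using assms(1) coeff_in_coeffs [of p i] by (cases "p = 0 \<or> degree p < i") (auto simp: coeff_eq_0)
  with assms(2) show ?thesis
    by (simp add: poly_altdef sum_nonneg)
qed

text \<open>Repeated squaring keeps the computation of explicit coefficients short.\<close>

lemma power4_squares: "(x::'a::monoid_mult) ^ 4 = (x\<^sup>2)\<^sup>2"
  and power8_squares: "x ^ 8 = ((x\<^sup>2)\<^sup>2)\<^sup>2"
  by (simp_all flip: power_mult)

lemma block_polynomials_base:
  fixes r :: real
  assumes "0 \<le> r"
  defines "P \<equiv> (1 + r) ^ 8" and "Q \<equiv> (1 + 2 * r) ^ 4" and "R \<equiv> (r * (r + 2)) ^ 4"
  shows "14 * ((P - Q)\<^sup>2 * (P - R)\<^sup>2) \<le> 11 * (R * (2 * P - R) * (Q * (2 * P - Q)))"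
proof -
  let ?P = "[:1, 1:] ^ 8" and ?Q = "[:1, 2:] ^ 4" and ?R = "[:0, 2, 1:] ^ 4"
  let ?p = "smult 11 (?R * (smult 2 ?P - ?R) * (?Q * (smult 2 ?P - ?Q)))
    - smult 14 ((?P - ?Q)\<^sup>2 * (?P - ?R)\<^sup>2)"
  have "\<forall>c\<in>set (coeffs ?p). 0 \<le> (c::real)"
    by (simp add: power8_squares power4_squares power2_eq_square)
  then have "0 \<le> poly ?p r"
    using assms(1) by (rule poly_nonneg_if_coeffs_nonneg)
  moreover have "poly ?P r = P" "poly ?Q r = Q" "poly ?R r = R"
    by (simp_all add: P_def Q_def R_def algebra_simps)
  ultimately show ?thesis
    by (simp only: poly_diff poly_mult poly_smult poly_power diff_ge_0_iff_ge)
qed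

text \<open>The extremal case of the factor 14/11: odds \<open>11 * t\<close> and
  \<open>14 * t\<close>, scaled so that all coefficients are integers.\<close>

lemma block_polynomials_step:
  fixes t :: real
  assumes "0 \<le> t"
  defines "P \<equiv> (1 + 11 * t) ^ 8" and "R \<equiv> (11 * t * (11 * t + 2)) ^ 4"
    and "P' \<equiv> (1 + 14 * t) ^ 8" and "Q' \<equiv> (1 + 2 * (14 * t)) ^ 4"
  shows "14 * (R * (2 * P - R) * (Q' * (2 * P' - Q'))) \<le> 11 * ((P' - Q')\<^sup>2 * (P - R)\<^sup>2)"
proof -
  let ?P = "[:1, 11:] ^ 8" and ?R = "[:0, 22, 121:] ^ 4"
  let ?P' = "[:1, 14:] ^ 8" and ?Q' = "[:1, 28:] ^ 4"
  let ?p = "smult 11 ((?P' - ?Q')\<^sup>2 * (?P - ?R)\<^sup>2)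
    - smult 14 (?R * (smult 2 ?P - ?R) * (?Q' * (smult 2 ?P' - ?Q')))"
  \<comment> \<open>The tightness for small odds shows in the coefficient of \<open>t ^ 4\<close>, a
    positive multiple of \<open>14 ^ 3 - 2 * 11 ^ 3 = 82\<close>.\<close>
  have "\<forall>c\<in>set (coeffs ?p). 0 \<le> (c::real)"
    by (simp add: power8_squares power4_squares power2_eq_square)
  then have "0 \<le> poly ?p t"
    using assms(1) by (rule poly_nonneg_if_coeffs_nonneg)
  moreover have "poly ?P t = P" "poly ?R t = R" "poly ?P' t = P'" "poly ?Q' t = Q'"
    by (simp_all add: P_def R_def P'_def Q'_def algebra_simps)
  ultimately show ?thesis
    by (simp only: poly_diff poly_mult poly_smult poly_power diff_ge_0_iff_ge)
qed

text \<open>Both \<open>1 + 2 * r\<close> and \<open>r * (r + 2)\<close> lie below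
  \<open>(1 + r)\<^sup>2\<close>; take fourth powers.\<close>

lemma block_denominators_pos:
  fixes r :: real
  assumes "0 < r"
  shows "0 < (1 + 2 * r) ^ 4 * (2 * (1 + r) ^ 8 - (1 + 2 * r) ^ 4)"
    and "0 < ((1 + r) ^ 8 - (r * (r + 2)) ^ 4)\<^sup>2"
proof -
  have P: "(1 + r) ^ 8 = ((1 + r)\<^sup>2) ^ 4"
    by (simp flip: power_mult)
  have lt: "(1 + 2 * r) ^ 4 < (1 + r) ^ 8" "(r * (r + 2)) ^ 4 < (1 + r) ^ 8"
    unfolding P using assms
    by (intro power_strict_mono; simp add: power2_eq_square algebra_simps add_pos_pos)+
  have Q: "0 < (1 + 2 * r) ^ 4"
    using assms by simp
  have "0 < 2 * p - q" if "0 < q" "q < p" for p q :: real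
    using that by linarith
  then show "0 < (1 + 2 * r) ^ 4 * (2 * (1 + r) ^ 8 - (1 + 2 * r) ^ 4)"
    using Q lt(1) by (intro mult_pos_pos)
  show "0 < ((1 + r) ^ 8 - (r * (r + 2)) ^ 4)\<^sup>2"
    using lt(2) by (intro zero_less_power) (simp only: diff_gt_0_iff_gt)
qed

lemma odds_block_base:
  assumes "0 < r"
  shows "14 * odds_poly (block False) r \<le> 11 * odds_poly (block True) r"
  unfolding odds_block_False [OF assms] odds_block_True [OF assms]
  using assms
  by (intro scaled_divide_le_scaled_divide block_denominators_pos block_polynomials_base) simp_all

lemma odds_block_step:
  assumes "0 < t"
  shows "14 * odds_poly (block True) (11 * t) \<le> 11 * odds_poly (block False) (14 * t)"
proof -
  have "0 < 11 * t" "0 < 14 * t"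
    using assms by simp_all
  then show ?thesis
    unfolding odds_block_True [OF \<open>0 < 11 * t\<close>] odds_block_False [OF \<open>0 < 14 * t\<close>]
    using assms
    by (intro scaled_divide_le_scaled_divide block_denominators_pos block_polynomials_step) simp_all
qed

section \<open>Propagating the gap\<close>

text \<open>Monotonicity reduces 1001 to the extremal case \<open>s = 14 * (r / 11)\<close>, and
  0110 to equal odds \<open>r\<close>, where the factor arises afresh.\<close>

lemma odds_block_gap:
  assumes "0 < r" "14 * r \<le> 11 * s"
  shows "14 * odds_poly (block b) r \<le> 11 * odds_poly (block (\<not> b)) s"
proof (cases b)
  case True
  have "odds_poly (block False) (14 * (r / 11)) \<le> odds_poly (block False) s"
    using assms by (intro odds_poly_mono) simp_all
  with True odds_block_step [of "r / 11"] assms show ?thesis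
    by simp
next
  case False
  have "odds_poly (block True) r \<le> odds_poly (block True) s"
    using assms by (intro odds_poly_mono) simp_all
  with False odds_block_base [OF assms(1)] show ?thesis
    by simp
qed

lemma odds_blocks_gap:
  assumes "0 < r" "14 * r \<le> 11 * s"
  shows "14 * odds_poly (concat (map block bs)) r
           \<le> 11 * odds_poly (concat (map block (map Not bs))) s"
  using assms
proof (induction bs arbitrary: r s)
  case (Cons b bs)
  show ?case
    using Cons.IH [OF odds_poly_pos odds_block_gap] Cons.prems
    by (simp add: odds_poly_append)
qed simp

lemma blocks_rel_le:
  "concat (map block (False # bs)) \<preceq> concat (map block (map Not (False # bs)))"
proof (rule rel_le_if_odds_le)
  fix r :: real
  assume r: "0 < r"
  let ?v = "concat (map block (False # bs))"
  have "14 * odds_poly ?v r \<le> 11 * odds_poly (concat (map block (map Not (False # bs)))) r"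
    using odds_blocks_gap [OF odds_poly_pos [OF r] odds_block_base [OF r], of bs]
    by (simp add: odds_poly_append)
  \<comment> \<open>The odds are positive, so a factor of 14/11 implies the plain
    inequality.\<close>
  then show "odds_poly ?v r \<le> odds_poly (concat (map block (map Not (False # bs)))) r"
    using odds_poly_pos [OF r, of ?v] by linarith
qed

section \<open>Block structure of the Thue--Morse word\<close>

lemma bit_complement_blocks:
  "bit_complement (concat (map block bs)) = concat (map block (map Not bs))"
  by (induction bs) (simp_all add: bit_complement_def block_def)

text \<open>Indices start at 1, so these compare the binary digit sums of \<open>2 * n\<close> and
  \<open>2 * n + 1\<close> with that of \<open>n\<close>: a digit 0 or 1 is appended.\<close>

lemma thue_morse_double:
  "thue_morse (Suc (2 * n)) = thue_morse (Suc n)"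
  "thue_morse (Suc (Suc (2 * n))) = (\<not> thue_morse (Suc n))"
  using odd_card_bits_rec [of "2 * n"] odd_card_bits_rec [of "2 * n + 1"]
  by (simp_all add: thue_morse_def)

lemma thue_morse_block:
  "map thue_morse [4 * n + 1, 4 * n + 2, 4 * n + 3, 4 * n + 4] = block (thue_morse (Suc n))"
proof -
  \<comment> \<open>These shapes let the doubling rules apply twice to each index.\<close>
  have "4 * n + 1 = Suc (2 * (2 * n))" "4 * n + 2 = Suc (Suc (2 * (2 * n)))"
    "4 * n + 3 = Suc (2 * Suc (2 * n))" "4 * n + 4 = Suc (Suc (2 * Suc (2 * n)))"
    by simp_all
  then show ?thesis
    by (simp only: list.map thue_morse_double block_def not_not)
qed

lemma thue_morse_prefix_blocks:
  "thue_morse_prefix (4 * k) = concat (map block (thue_morse_prefix k))"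
proof (induction k)
  case 0
  show ?case by (simp add: thue_morse_prefix_def)
next
  case (Suc k)
  have "[1..<Suc (4 * Suc k)] = [1..<Suc (4 * k)] @ [4 * k + 1, 4 * k + 2, 4 * k + 3, 4 * k + 4]"
  proof -
    have "Suc (4 * Suc k) = Suc (Suc (Suc (Suc (Suc (4 * k)))))"
      by simp
    then show ?thesis
      by (simp only: upt_Suc) simp
  qed
  then have "thue_morse_prefix (4 * Suc k) = thue_morse_prefix (4 * k) @ block (thue_morse (Suc k))"
    by (simp only: thue_morse_prefix_def map_append thue_morse_block)
  with Suc show ?case
    by (simp add: thue_morse_prefix_def)
qed

lemma thue_morse_prefix_Cons:
  assumes "k \<ge> 1"
  shows "\<exists>w. thue_morse_prefix k = False # w"
  using assms by (simp add: thue_morse_prefix_def upt_conv_Cons thue_morse_def del: upt_Suc)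

theorem proposition11:
  fixes k :: nat
  assumes "k \<ge> 1"
  shows "thue_morse_prefix (4 * k) \<preceq> bit_complement (thue_morse_prefix (4 * k))"
proof -
  obtain bs where "thue_morse_prefix k = False # bs"
    using thue_morse_prefix_Cons [OF assms] by blast
  then show ?thesis
    using blocks_rel_le [of bs] by (simp only: thue_morse_prefix_blocks bit_complement_blocks)
qed

end
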